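(* Let $(P,\mathrm{Ex},\langle\!\langle\cdot,\cdot\rangle\!\rangle)$ be a linear realisability situation such that the measurement is symmetric, and in which there exist elements $id, \tau \in P$ such that for all $p, q \in P$: \[ \begin{array}{lll} \mathrm{Ex}(id, p) = p, &\hspace{2em}& \langle\!\langle id, p\rangle\!\rangle = 0, \\ \mathrm{Ex}(\mathrm{Ex}(\tau, p), q) = \mathrm{Ex}(q, p), && \langle\!\langle \tau, p\rangle\!\rangle = 0. \end{array} \] Then $(\mathbf{\Pi}, \subseteq, \multimap, \mathbf{\Pi} \setminus \{\emptyset\})$, where $\mathbf{\Pi}$ is the set of all types, is a consistent linear implicative algebra.
   Context: Fix a commutative group $(\Theta,+,0)$. A linear realisability situation is a triple $(P,\mathrm{Ex},\langle\!\langle\cdot,\cdot\rangle\!\rangle)$ where $P$ is a set (of programs), $\mathrm{Ex}:P\times P\to P$ is an associative operation, and $\langle\!\langle\cdot,\cdot\rangle\!\rangle:P\times P\to\Theta$ satisfies $\langle\!\langle \mathrm{Ex}(p,q),r\rangle\!\rangle+\langle\!\langle p,q\rangle\!\rangle=\langle\!\langle p,\mathrm{Ex}(q,r)\rangle\!\rangle+\langle\!\langle q,r\rangle\!\rangle$ for all $p,q,r$. A project is a pair $\alpha\cdot a\in\Theta\times P$, with $\mathrm{Ex}(\alpha\cdot a,\beta\cdot b)=(\alpha+\beta+\langle\!\langle a,b\rangle\!\rangle)\cdot\mathrm{Ex}(a,b)$ and $\langle\!\langle\alpha\cdot a,\beta\cdot b\rangle\!\rangle=\alpha+\beta+\langle\!\langle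 a,b\rangle\!\rangle$. Given a fixed subset $\mathcal{O}\subseteq\Theta$ (the pole), $\alpha\cdot a\perp\beta\cdot b$ iff $\langle\!\langle\alpha\cdot a,\beta\cdot b\rangle\!\rangle\in\mathcal{O}$; for a set $X$ of projects, $X^\perp=\{\alpha\cdot a\mid\forall \xi\cdot x\in X,\ \xi\cdot x\perp\alpha\cdot a\}$. Types are sets $A$ of projects with $A=A^{\perp\perp}$; $\mathbf{\Pi}$ is the set of types, and $A\multimap B=\{\xi\cdot x\mid\forall\alpha\cdot a\in A,\ \mathrm{Ex}(\xi\cdot x,\alpha\cdot a)\in B\}$. An implicative structure is a complete lattice $(\mathscr{A},\preceq)$ with a binary operation $\multimap$ antitone in its first and monotone in its second argument, with $a\multimap\bigwedge_{b\in B}b=\bigwedge_{b\in B}(a\multimap b)$. With $\mathbf{I}^\mathscr{A}=\bigwedge_a(a\multimap a)$, $\mathbf{B}^\mathscr{A}=\bigwedge_{a,b,c}((b\multimap c)\multimap(a\multimap b)\multimap a\multimap c)$, $\mathbf{C}^\mathscr{A}=\bigwedge_{a,b,c}((a\multimap b\multimap c)\multimap b\multimap a\multimap c)$, a linear separator is a subset $S\subseteq\mathscr{A}$ that is upward closed, contains $\mathbf{I}^\mathscr{A},\mathbf{B}^\mathscr{A},\mathbf{C}^\mathscr{A}$, and is closed under modus ponens ($a\in S$ and $a\multimap b\in S$ imply $b\in S$); it is consistent if $\bot\notin S$. A (consistent) linear implicative algebra is an implicative structure equipped with a (consistent) linear separator.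
   Formalization: Consistency is claimed only when the pole 𝒪 is a proper subset of Θ; for 𝒪 = Θ the only type is the set of all projects, so ⊥ is nonempty and the algebra is inconsistent. The rest holds for every pole. *)

theory Defs
  imports "HOL-Algebra.Complete_Lattice"
begin

locale linear_realisability_situation =
  fixes exec :: "'p \<Rightarrow> 'p \<Rightarrow> 'p"
    and meas :: "'p \<Rightarrow> 'p \<Rightarrow> 'th::ab_group_add"
  assumes exec_assoc: "exec (exec p q) r = exec p (exec q r)"
    and meas_exec: "meas (exec p q) r + meas p q = meas p (exec q r) + meas q r"

type_synonym ('th, 'p) project = "'th \<times> 'p"

definition proj_meas ::
  "('p \<Rightarrow> 'p \<Rightarrow> 'th::ab_group_add) \<Rightarrow> ('th, 'p) project \<Rightarrow> ('th, 'p) project \<Rightarrow> 'th" where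
  "proj_meas meas x y = fst x + fst y + meas (snd x) (snd y)"

definition proj_exec ::
  "('p \<Rightarrow> 'p \<Rightarrow> 'p) \<Rightarrow> ('p \<Rightarrow> 'p \<Rightarrow> 'th::ab_group_add)
    \<Rightarrow> ('th, 'p) project \<Rightarrow> ('th, 'p) project \<Rightarrow> ('th, 'p) project" where
  "proj_exec exec meas x y =
     (fst x + fst y + meas (snd x) (snd y), exec (snd x) (snd y))"

definition orthogonal ::
  "('p \<Rightarrow> 'p \<Rightarrow> 'th::ab_group_add) \<Rightarrow> 'th set
    \<Rightarrow> ('th, 'p) project \<Rightarrow> ('th, 'p) project \<Rightarrow> bool" where
  "orthogonal meas Pole x y \<longleftrightarrow> proj_meas meas x y \<in> Pole"

definition orth ::
  "('p \<Rightarrow> 'p \<Rightarrow> 'th::ab_group_add) \<Rightarrow> 'th set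
    \<Rightarrow> ('th, 'p) project set \<Rightarrow> ('th, 'p) project set" where
  "orth meas Pole X = {y. \<forall>x\<in>X. orthogonal meas Pole x y}"

definition types ::
  "('p \<Rightarrow> 'p \<Rightarrow> 'th::ab_group_add) \<Rightarrow> 'th set \<Rightarrow> ('th, 'p) project set set" where
  "types meas Pole = {A. A = orth meas Pole (orth meas Pole A)}"

definition lollipop ::
  "('p \<Rightarrow> 'p \<Rightarrow> 'p) \<Rightarrow> ('p \<Rightarrow> 'p \<Rightarrow> 'th::ab_group_add)
    \<Rightarrow> ('th, 'p) project set \<Rightarrow> ('th, 'p) project set \<Rightarrow> ('th, 'p) project set" where
  "lollipop exec meas A B = {x. \<forall>a\<in>A. proj_exec exec meas x a \<in> B}"

definition type_order ::
  "('p \<Rightarrow> 'p \<Rightarrow> 'th::ab_group_add) \<Rightarrow> 'th set \<Rightarrow> ('th, 'p) project set gorder" where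
  "type_order meas Pole = \<lparr>carrier = types meas Pole, eq = (=), le = (\<subseteq>)\<rparr>"

locale implicative_structure = complete_lattice L for L (structure) +
  fixes imp :: "'a \<Rightarrow> 'a \<Rightarrow> 'a" (infixr \<open>\<rightarrow>\<^sub>l\<close> 60)
  assumes imp_closed: "\<lbrakk>a \<in> carrier L; b \<in> carrier L\<rbrakk> \<Longrightarrow> a \<rightarrow>\<^sub>l b \<in> carrier L"
    and imp_antitone: "\<lbrakk>a \<in> carrier L; a' \<in> carrier L; b \<in> carrier L; a \<sqsubseteq> a'\<rbrakk>
      \<Longrightarrow> a' \<rightarrow>\<^sub>l b \<sqsubseteq> a \<rightarrow>\<^sub>l b"
    and imp_mono: "\<lbrakk>a \<in> carrier L; b \<in> carrier L; b' \<in> carrier L; b \<sqsubseteq> b'\<rbrakk>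
      \<Longrightarrow> a \<rightarrow>\<^sub>l b \<sqsubseteq> a \<rightarrow>\<^sub>l b'"
    and imp_inf: "\<lbrakk>a \<in> carrier L; B \<subseteq> carrier L\<rbrakk>
      \<Longrightarrow> a \<rightarrow>\<^sub>l \<Sqinter>B = \<Sqinter>{a \<rightarrow>\<^sub>l b | b. b \<in> B}"

definition comb_I :: "'a gorder \<Rightarrow> ('a \<Rightarrow> 'a \<Rightarrow> 'a) \<Rightarrow> 'a" where
  "comb_I L imp = \<Sqinter>\<^bsub>L\<^esub>{imp a a | a. a \<in> carrier L}"

definition comb_B :: "'a gorder \<Rightarrow> ('a \<Rightarrow> 'a \<Rightarrow> 'a) \<Rightarrow> 'a" where
  "comb_B L imp = \<Sqinter>\<^bsub>L\<^esub>{imp (imp b c) (imp (imp a b) (imp a c)) | a b c.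
     a \<in> carrier L \<and> b \<in> carrier L \<and> c \<in> carrier L}"

definition comb_C :: "'a gorder \<Rightarrow> ('a \<Rightarrow> 'a \<Rightarrow> 'a) \<Rightarrow> 'a" where
  "comb_C L imp = \<Sqinter>\<^bsub>L\<^esub>{imp (imp a (imp b c)) (imp b (imp a c)) | a b c.
     a \<in> carrier L \<and> b \<in> carrier L \<and> c \<in> carrier L}"

definition linear_separator :: "'a gorder \<Rightarrow> ('a \<Rightarrow> 'a \<Rightarrow> 'a) \<Rightarrow> 'a set \<Rightarrow> bool" where
  "linear_separator L imp S \<longleftrightarrow>
     S \<subseteq> carrier L \<and>
     (\<forall>a\<in>S. \<forall>b\<in>carrier L. a \<sqsubseteq>\<^bsub>L\<^esub> b \<longrightarrow> b \<in> S) \<and>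
     comb_I L imp \<in> S \<and> comb_B L imp \<in> S \<and> comb_C L imp \<in> S \<and>
     (\<forall>a\<in>carrier L. \<forall>b\<in>carrier L. a \<in> S \<and> imp a b \<in> S \<longrightarrow> b \<in> S)"

definition linear_implicative_algebra ::
  "'a gorder \<Rightarrow> ('a \<Rightarrow> 'a \<Rightarrow> 'a) \<Rightarrow> 'a set \<Rightarrow> bool" where
  "linear_implicative_algebra L imp S \<longleftrightarrow>
     implicative_structure L imp \<and> linear_separator L imp S"

definition consistent_linear_implicative_algebra ::
  "'a gorder \<Rightarrow> ('a \<Rightarrow> 'a \<Rightarrow> 'a) \<Rightarrow> 'a set \<Rightarrow> bool" where
  "consistent_linear_implicative_algebra L imp S \<longleftrightarrow>
     linear_implicative_algebra L imp S \<and> \<bottom>\<^bsub>L\<^esub> \<notin> S"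

text \<open>
  Consistency requires the pole to be a proper subset: for the full pole the only type is the set
  of all projects, so the least type is non-empty and belongs to every separator.
\<close>

lemma types_full_pole: "types meas UNIV = {UNIV}"
  by (auto simp: types_def orth_def orthogonal_def)

lemma full_pole_not_consistent:
  "\<not> consistent_linear_implicative_algebra (type_order meas UNIV) imp (types meas UNIV - {{}})"
proof -
  have "\<bottom>\<^bsub>type_order meas UNIV\<^esub> = UNIV"
    by (simp add: bottom_def type_order_def types_full_pole least_def Upper_def)
  then show ?thesis
    by (simp add: consistent_linear_implicative_algebra_def types_full_pole)
qed

end

theory Submission
  imports Defs
begin

text \<open>
  The hypotheses on \<open>\<tau>\<close> force \<^emph>\<open>exec\<close> to be commutative: associativity turns the exchange law
  into \<open>\<tau>(pq) = qp\<close>, so \<open>p = id\<close> gives \<open>\<tau>q = q id\<close>, and then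
  \<open>qp = (\<tau>p)q = (p id)q = p(id q) = pq\<close>. Hence the projects form a commutative monoid with unit
  \<open>0 \<cdot> id\<close>, in which two projects are orthogonal iff the scalar of their product lies in the pole.
  Types are then the facts of a phase space: they are closed under intersections,
  \<open>A \<multimap> B = (A B\<^sup>\<perp>)\<^sup>\<perp>\<close>, and the unit lies in every instance of \<open>I\<close>, \<open>B\<close> and \<open>C\<close>.
\<close>

lemma orth_antimono: "X \<subseteq> Y \<Longrightarrow> orth meas Pole Y \<subseteq> orth meas Pole X"
  by (auto simp: orth_def)

lemma lollipop_antimono_mono:
  "\<lbrakk>A \<subseteq> A'; B \<subseteq> B'\<rbrakk> \<Longrightarrow> lollipop exec meas A' B \<subseteq> lollipop exec meas A B'"
  by (auto simp: lollipop_def)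

lemma lollipop_Inter: "lollipop exec meas A (\<Inter>\<B>) = \<Inter>{lollipop exec meas A B | B. B \<in> \<B>}"
  by (auto simp: lollipop_def)

lemma carrier_type_order [simp]: "carrier (type_order meas Pole) = types meas Pole"
  and le_type_order [simp]: "A \<sqsubseteq>\<^bsub>type_order meas Pole\<^esub> B \<longleftrightarrow> A \<subseteq> B"
  and eq_type_order [simp]: "A .=\<^bsub>type_order meas Pole\<^esub> B \<longleftrightarrow> A = B"
  by (simp_all add: type_order_def)

lemma partial_order_type_order: "partial_order (type_order meas Pole)"
  by unfold_locales (auto simp: type_order_def)

text \<open>Commutativity of \<open>exec\<close> stands in for the exchange law of
  \<open>\<tau>\<close>; the final theorem derives it before interpreting this locale.\<close>

locale commutative_realisability = linear_realisability_situation exec meas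
  for exec :: "'p \<Rightarrow> 'p \<Rightarrow> 'p" and meas :: "'p \<Rightarrow> 'p \<Rightarrow> 'th::ab_group_add" +
  fixes ident :: 'p and Pole :: "'th set"
  assumes meas_commute: "meas p q = meas q p"
    and exec_commute: "exec p q = exec q p"
    and exec_ident: "exec ident p = p"
    and meas_ident: "meas ident p = 0"
begin

abbreviation mult (infixl \<open>\<star>\<close> 70) where "x \<star> y \<equiv> proj_exec exec meas x y"
abbreviation dual (\<open>_\<^sup>\<perp>\<close> [1000] 1000) where "X\<^sup>\<perp> \<equiv> orth meas Pole X"
abbreviation implies (infixr \<open>\<multimap>\<close> 60) where "A \<multimap> B \<equiv> lollipop exec meas A B"
abbreviation Types where "Types \<equiv> types meas Pole"
abbreviation unit_project where "unit_project \<equiv> (0, ident)"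

lemma mult_commute: "x \<star> y = y \<star> x"
  by (simp add: proj_exec_def exec_commute meas_commute add.commute)

text \<open>The cocycle law \<open>meas_exec\<close> is what makes the scalars of the two sides
  agree.\<close>

lemma mult_assoc: "(x \<star> y) \<star> z = x \<star> (y \<star> z)"
  using meas_exec[of "snd x" "snd y" "snd z"]
  by (simp add: proj_exec_def exec_assoc algebra_simps)

lemma unit_mult: "unit_project \<star> x = x"
  by (simp add: proj_exec_def exec_ident meas_ident)

lemma orth_iff: "y \<in> X\<^sup>\<perp> \<longleftrightarrow> (\<forall>x\<in>X. fst (x \<star> y) \<in> Pole)"
  by (simp add: orth_def orthogonal_def proj_meas_def proj_exec_def)

lemma subset_biorth: "X \<subseteq> X\<^sup>\<perp>\<^sup>\<perp>"
  by (auto simp: orth_iff mult_commute)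

lemma types_iff: "A \<in> Types \<longleftrightarrow> A\<^sup>\<perp>\<^sup>\<perp> \<subseteq> A"
  using subset_biorth by (auto simp: types_def)

text \<open>Antitonicity applied to \<open>X \<subseteq> X\<^sup>\<perp>\<^sup>\<perp>\<close> puts
  the triple orthogonal inside the single one.\<close>

lemma orth_type: "X\<^sup>\<perp> \<in> Types"
  by (simp add: types_iff orth_antimono subset_biorth)

lemma Inter_type:
  assumes "\<B> \<subseteq> Types"
  shows "\<Inter>\<B> \<in> Types"
proof -
  have "(\<Inter>\<B>)\<^sup>\<perp>\<^sup>\<perp> \<subseteq> B" if "B \<in> \<B>" for B
  proof -
    have "(\<Inter>\<B>)\<^sup>\<perp>\<^sup>\<perp> \<subseteq> B\<^sup>\<perp>\<^sup>\<perp>"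
      using that by (intro orth_antimono) auto
    then show ?thesis
      using assms that types_iff by blast
  qed
  then show ?thesis
    by (auto simp: types_iff)
qed

text \<open>Since \<open>B\<close> is the orthogonal of \<open>B\<^sup>\<perp>\<close>, membership
  of \<open>x \<star> a\<close> in \<open>B\<close> is tested against
  \<open>B\<^sup>\<perp>\<close>, and \<open>a\<close> can be moved over to the test. Being an
  orthogonal makes \<open>A \<multimap> B\<close> a type for an arbitrary set
  \<open>A\<close>.\<close>

lemma lollipop_eq_orth:
  assumes "B \<in> Types"
  shows "A \<multimap> B = {a \<star> y | a y. a \<in> A \<and> y \<in> B\<^sup>\<perp>}\<^sup>\<perp>"
proof -
  have B: "B = B\<^sup>\<perp>\<^sup>\<perp>"
    using assms by (simp add: types_def)
  have "x \<star> a \<in> B \<longleftrightarrow> (\<forall>y\<in>B\<^sup>\<perp>. fst ((a \<star> y) \<star> x) \<in> Pole)" for x a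
  proof -
    have "(a \<star> y) \<star> x = y \<star> (x \<star> a)" for y
      by (metis mult_assoc mult_commute)
    then show ?thesis
      \<comment> \<open>Fixing the set in \<open>orth_iff\<close> keeps the bound
        \<open>y \<in> B\<^sup>\<perp>\<close> folded.\<close>
      by (subst B) (simp add: orth_iff[of _ "B\<^sup>\<perp>"])
  qed
  then have "x \<in> A \<multimap> B \<longleftrightarrow> x \<in> {a \<star> y | a y. a \<in> A \<and> y \<in> B\<^sup>\<perp>}\<^sup>\<perp>" for x
    unfolding lollipop_def orth_iff[of x] by blast
  then show ?thesis
    by blast
qed

lemma lollipop_type: "B \<in> Types \<Longrightarrow> A \<multimap> B \<in> Types"
  by (simp add: lollipop_eq_orth orth_type)

lemma greatest_Inter:
  assumes "\<B> \<subseteq> Types"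
  shows "greatest (type_order meas Pole) (\<Inter>\<B>) (Lower (type_order meas Pole) \<B>)"
  using assms Inter_type[OF assms] by (auto simp: greatest_def Lower_def)

lemma inf_type_order:
  assumes "\<B> \<subseteq> Types"
  shows "\<Sqinter>\<^bsub>type_order meas Pole\<^esub> \<B> = \<Inter>\<B>"
  unfolding Lattice.inf_def
  \<comment> \<open>The infimum is a choice among greatest lower bounds, so their uniqueness is
    needed too.\<close>
  by (rule some_equality)
    (use greatest_Inter[OF assms] partial_order.greatest_unique[OF partial_order_type_order]
      in blast)+

lemma complete_lattice_type_order: "complete_lattice (type_order meas Pole)"
proof (rule partial_order.complete_lattice_criterion1[OF partial_order_type_order])
  show "\<exists>g. greatest (type_order meas Pole) g (carrier (type_order meas Pole))"
    \<comment> \<open>The empty intersection \<open>UNIV\<close> is the top type.\<close>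
    using Inter_type[of "{}"] by (auto simp: greatest_def)
qed (use greatest_Inter in auto)

lemma implicative_structure_types:
  "implicative_structure (type_order meas Pole) (lollipop exec meas)"
proof -
  interpret complete_lattice "type_order meas Pole"
    by (rule complete_lattice_type_order)
  show ?thesis
  proof
    fix A \<B>
    assume "A \<in> carrier (type_order meas Pole)" "\<B> \<subseteq> carrier (type_order meas Pole)"
    then have "\<B> \<subseteq> Types" "{A \<multimap> B | B. B \<in> \<B>} \<subseteq> Types"
      by (auto intro: lollipop_type)
    then show "A \<multimap> \<Sqinter>\<^bsub>type_order meas Pole\<^esub> \<B>
        = \<Sqinter>\<^bsub>type_order meas Pole\<^esub> {A \<multimap> B | B. B \<in> \<B>}"
      by (simp add: inf_type_order lollipop_Inter)
  \<comment> \<open>The rotation makes membership the major premise of the destruction rule.\<close>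
  qed (auto simp: lollipop_type dest: lollipop_antimono_mono[THEN subsetD, rotated 2])
qed

text \<open>This reduces the conditions on \<open>I\<close>, \<open>B\<close> and \<open>C\<close>
  to inclusions of types.\<close>

lemma unit_in_lollipop: "unit_project \<in> A \<multimap> B \<longleftrightarrow> A \<subseteq> B"
  by (auto simp: lollipop_def unit_mult)

text \<open>Associativity: \<open>(x \<star> f) \<star> a = x \<star> (f \<star> a)\<close>.\<close>

lemma compose_lollipop: "B \<multimap> C \<subseteq> (A \<multimap> B) \<multimap> A \<multimap> C"
  by (auto simp: lollipop_def mult_assoc)

lemma exchange_lollipop: "A \<multimap> B \<multimap> C \<subseteq> B \<multimap> A \<multimap> C"
proof
  fix x
  assume x: "x \<in> A \<multimap> B \<multimap> C"
  have "(x \<star> b) \<star> a \<in> C" if "a \<in> A" "b \<in> B" for a b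
  proof -
    have "(x \<star> b) \<star> a = (x \<star> a) \<star> b"
      by (metis mult_assoc mult_commute)
    then show ?thesis
      using x that by (simp add: lollipop_def)
  qed
  then show "x \<in> B \<multimap> A \<multimap> C"
    by (simp add: lollipop_def)
qed

lemma inf_in_separator:
  assumes "\<B> \<subseteq> Types" and "\<And>B. B \<in> \<B> \<Longrightarrow> unit_project \<in> B"
  shows "\<Sqinter>\<^bsub>type_order meas Pole\<^esub> \<B> \<in> Types - {{}}"
proof -
  have "unit_project \<in> \<Inter>\<B>"
    using assms(2) by blast
  then have "\<Inter>\<B> \<noteq> {}"
    by (metis empty_iff)
  then show ?thesis
    using Inter_type[OF assms(1)] by (simp add: inf_type_order[OF assms(1)])
qed

lemma linear_separator_types:
  "linear_separator (type_order meas Pole) (lollipop exec meas) (Types - {{}})"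
  unfolding linear_separator_def
proof (intro conjI)
  show "comb_I (type_order meas Pole) (lollipop exec meas) \<in> Types - {{}}"
    unfolding comb_I_def
    by (rule inf_in_separator) (auto simp: lollipop_type unit_in_lollipop)
  show "comb_B (type_order meas Pole) (lollipop exec meas) \<in> Types - {{}}"
    unfolding comb_B_def
    by (rule inf_in_separator)
      (auto simp: lollipop_type unit_in_lollipop intro: compose_lollipop[THEN subsetD])
  show "comb_C (type_order meas Pole) (lollipop exec meas) \<in> Types - {{}}"
    unfolding comb_C_def
    by (rule inf_in_separator)
      (auto simp: lollipop_type unit_in_lollipop intro: exchange_lollipop[THEN subsetD])
\<comment> \<open>For modus ponens, the product of an element of \<open>A \<multimap> B\<close> with
  one of \<open>A\<close> inhabits \<open>B\<close>.\<close>
qed (auto simp: lollipop_def)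

lemma empty_type:
  assumes "Pole \<noteq> UNIV"
  shows "{} \<in> Types"
proof -
  obtain \<theta> where "\<theta> \<notin> Pole"
    using assms by auto
  \<comment> \<open>Scalars are free, so every project has a partner whose pairing with it is the
    excluded value \<open>\<theta>\<close>.\<close>
  moreover have "fst ((\<theta> - fst y, ident) \<star> y) = \<theta>" for y
    by (simp add: proj_exec_def meas_ident)
  ultimately have "UNIV\<^sup>\<perp> = {}"
    by (metis UNIV_I equals0I orth_iff)
  then show ?thesis
    using orth_type by metis
qed

lemma bottom_type_order:
  assumes "Pole \<noteq> UNIV"
  shows "\<bottom>\<^bsub>type_order meas Pole\<^esub> = {}"
  unfolding bottom_def
  by (rule some_equality) (use empty_type[OF assms] in \<open>auto simp: least_def\<close>)

end

theorem theorem3p1: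
  fixes exec :: "'p \<Rightarrow> 'p \<Rightarrow> 'p"
    and meas :: "'p \<Rightarrow> 'p \<Rightarrow> 'th::ab_group_add"
    and Pole :: "'th set"
    and ident \<tau> :: 'p
  assumes "linear_realisability_situation exec meas"
    and "\<forall>p q. meas p q = meas q p"
    and "\<forall>p. exec ident p = p"
    and "\<forall>p. meas ident p = 0"
    and "\<forall>p q. exec (exec \<tau> p) q = exec q p"
    and "\<forall>p. meas \<tau> p = 0"
  shows "linear_implicative_algebra
           (type_order meas Pole) (lollipop exec meas) (types meas Pole - {{}})
       \<and> (Pole \<noteq> UNIV \<longrightarrow> consistent_linear_implicative_algebra
           (type_order meas Pole) (lollipop exec meas) (types meas Pole - {{}}))"
proof -
  interpret linear_realisability_situation exec meas
    by fact
  have tau: "exec \<tau> q = exec q ident" for q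
    using assms(3,5) exec_assoc by metis
  have "exec q p = exec p q" for p q
    using assms(3,5) exec_assoc tau by metis
  then interpret commutative_realisability exec meas ident Pole
    using assms(2-4) by unfold_locales auto
  show ?thesis
    using implicative_structure_types linear_separator_types bottom_type_order
    by (auto simp: linear_implicative_algebra_def consistent_linear_implicative_algebra_def)
qed

end
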